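(* For each $x,y>0$, the function $(p,q)\mapsto B_{p,q}(x,y)$ is log-convex on $(0,\infty)\times(0,\infty)$. Moreover, for all $x,y>0$ and all $p,q>0$, the function $B_{p,q}(x,y)$ satisfies the Turán type inequality $$B_{p,q}(x,y)^2-B_{p+a,q+a}(x,y)\,B_{p-a,q-a}(x,y)\le 0$$ for all real $a$ such that $p+a,\ p-a,\ q+a,\ q-a>0$.
   Context: For real $p,q>0$ and $x,y>0$, the extended $(p,q)$-beta function is $$B_{p,q}(x,y)=\int_0^1 t^{x-1}(1-t)^{y-1}\exp\Big(-\frac{p}{t}-\frac{q}{1-t}\Big)\,dt .$$ A function $f>0$ on a convex set is log-convex if $f(\alpha u+(1-\alpha)v)\le f(u)^{\alpha}f(v)^{1-\alpha}$ for all $u,v$ in the set and all $\alpha\in(0,1)$. *)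

theory Defs
  imports "HOL-Analysis.Analysis"
begin

text \<open>
  The integral is taken over the open interval, so that the convention \<open>c / 0 = 0\<close> plays no role
  at the endpoints. For \<open>p, q > 0\<close> the integrand is positive and bounded there, hence integrable.
\<close>

definition ext_beta :: "real \<Rightarrow> real \<Rightarrow> real \<Rightarrow> real \<Rightarrow> real" where
  "ext_beta p q x y =
     (LBINT t:{0<..<1}. t powr (x - 1) * (1 - t) powr (y - 1) * exp (- p / t - q / (1 - t)))"

definition log_convex_on :: "'a::real_vector set \<Rightarrow> ('a \<Rightarrow> real) \<Rightarrow> bool" where
  "log_convex_on S f \<longleftrightarrow>
     convex S \<and> (\<forall>u\<in>S. f u > 0) \<and>
     (\<forall>u\<in>S. \<forall>v\<in>S. \<forall>\<alpha>\<in>{0<..<1}.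
        f (\<alpha> *\<^sub>R u + (1 - \<alpha>) *\<^sub>R v) \<le> f u powr \<alpha> * f v powr (1 - \<alpha>))"

end

theory Submission
  imports Defs
begin

text \<open>
  For fixed \<open>t\<close> the integrand of \<open>B_{p,q}(x,y)\<close> is a weight not depending on \<open>(p, q)\<close> times the
  exponential of a linear form in \<open>(p, q)\<close>. It is therefore log-affine in \<open>(p, q)\<close>: the integrand
  at \<open>\<alpha>u + (1 - \<alpha>)v\<close> is the weighted geometric mean of the integrands at \<open>u\<close> and \<open>v\<close>
  (\<open>ext_beta_kernel_log_affine\<close>). Hoelder's inequality (\<open>Hoelder_inequality_integral\<close>) bounds the
  integral of a geometric mean by the geometric mean of the integrals, which is exactly
  log-convexity. The kernel is dominated by that of the classical beta integral, so all integrals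
  converge, and they are positive because the kernel is.

  The Turan type inequality is log-convexity at the midpoint: \<open>(p, q)\<close> is halfway between
  \<open>(p + a, q + a)\<close> and \<open>(p - a, q - a)\<close>, so \<open>B_{p,q}\<close> is at most the geometric mean of the values
  at these two points.
\<close>

text \<open>
  This is Hoelder's inequality for the conjugate exponents \<open>1/\<alpha>\<close> and \<open>1/(1 - \<alpha>)\<close>, in the form that
  matches log-convexity. After scaling both integrals to 1 it is the integral of the pointwise
  inequality between weighted geometric and arithmetic means. If one of the integrals vanishes,
  scaling is impossible, but then the geometric mean is zero almost everywhere.
\<close>

lemma Hoelder_inequality_integral:
  fixes f g :: "'a \<Rightarrow> real"
  assumes f: "integrable M f" and g: "integrable M g"
    and f0: "\<And>x. f x \<ge> 0" and g0: "\<And>x. g x \<ge> 0"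
    and \<alpha>: "0 < \<alpha>" "\<alpha> < 1"
  shows "(LINT x|M. f x powr \<alpha> * g x powr (1 - \<alpha>))
           \<le> (LINT x|M. f x) powr \<alpha> * (LINT x|M. g x) powr (1 - \<alpha>)"
proof -
  have [measurable]: "f \<in> borel_measurable M" "g \<in> borel_measurable M"
    using f g by auto
  define A where "A = (LINT x|M. f x)"
  define B where "B = (LINT x|M. g x)"
  have "A \<ge> 0" "B \<ge> 0"
    unfolding A_def B_def using f0 g0 by (simp_all add: integral_nonneg_AE)
  then consider "A = 0 \<or> B = 0" | "A > 0" "B > 0"
    by linarith
  then have "(LINT x|M. f x powr \<alpha> * g x powr (1 - \<alpha>)) \<le> A powr \<alpha> * B powr (1 - \<alpha>)"
  proof cases
    case 1
    then have "(AE x in M. f x = 0) \<or> (AE x in M. g x = 0)"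
      using integral_nonneg_eq_0_iff_AE[OF f] integral_nonneg_eq_0_iff_AE[OF g] f0 g0
      by (auto simp: A_def B_def)
    then have "AE x in M. f x powr \<alpha> * g x powr (1 - \<alpha>) = 0"
      by (auto elim: eventually_mono)
    then have "(LINT x|M. f x powr \<alpha> * g x powr (1 - \<alpha>)) = 0"
      by (rule integral_eq_zero_AE)
    then show ?thesis
      by simp
  next
    case 2
    define h where "h = (\<lambda>x. \<alpha> * (f x / A) + (1 - \<alpha>) * (g x / B))"
    have h: "integrable M h"
      unfolding h_def using f g by auto
    have le: "f x powr \<alpha> * g x powr (1 - \<alpha>) \<le> A powr \<alpha> * B powr (1 - \<alpha>) * h x" for x
    proof (cases "f x = 0 \<or> g x = 0")
      case True
      then show ?thesis
        using 2 \<alpha> f0[of x] g0[of x] by (auto simp: h_def)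
    next
      case False
      then have pos: "f x > 0" "g x > 0"
        using f0[of x] g0[of x] by auto
      have "(f x / A) powr \<alpha> * (g x / B) powr (1 - \<alpha>) \<le> h x"
        unfolding h_def using \<alpha> 2 pos by (intro Youngs_inequality_0) auto
      then show ?thesis
        using 2 pos by (simp add: powr_divide field_simps)
    qed
    have "(LINT x|M. f x powr \<alpha> * g x powr (1 - \<alpha>))
            \<le> (LINT x|M. A powr \<alpha> * B powr (1 - \<alpha>) * h x)"
    proof (rule integral_mono)
      show "integrable M (\<lambda>x. A powr \<alpha> * B powr (1 - \<alpha>) * h x)"
        using h by auto
      then show "integrable M (\<lambda>x. f x powr \<alpha> * g x powr (1 - \<alpha>))"
        by (rule Bochner_Integration.integrable_bound)
           (auto intro!: AE_I2 order_trans[OF le])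
    qed (rule le)
    also have "(LINT x|M. h x) = 1"
      unfolding h_def using f g 2 by (simp add: A_def[symmetric] B_def[symmetric])
    then have "(LINT x|M. A powr \<alpha> * B powr (1 - \<alpha>) * h x) = A powr \<alpha> * B powr (1 - \<alpha>)"
      by simp
    finally show ?thesis .
  qed
  then show ?thesis
    by (simp add: A_def B_def)
qed

lemma set_integral_pos:
  fixes f :: "'a \<Rightarrow> real"
  assumes f: "set_integrable M A f" and pos: "\<And>x. x \<in> A \<Longrightarrow> f x > 0"
    and A: "A \<in> sets M" "emeasure M A > 0"
  shows "(LINT x:A|M. f x) > 0"
proof -
  have int: "integrable M (\<lambda>x. indicator A x *\<^sub>R f x)"
    using f by (simp add: set_integrable_def)
  have nonneg: "AE x in M. 0 \<le> indicator A x *\<^sub>R f x"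
    using pos by (auto simp: indicator_def less_imp_le)
  have "(LINT x:A|M. f x) \<noteq> 0"
  proof
    assume "(LINT x:A|M. f x) = 0"
    then have "AE x in M. indicator A x *\<^sub>R f x = 0"
      using integral_nonneg_eq_0_iff_AE[OF int nonneg] by (simp add: set_lebesgue_integral_def)
    then have "AE x in M. x \<notin> A"
      by eventually_elim (use pos in \<open>force simp: indicator_def\<close>)
    then show False
      using A by (simp add: AE_iff_null_sets[symmetric] null_sets_def)
  qed
  moreover have "(LINT x:A|M. f x) \<ge> 0"
    unfolding set_lebesgue_integral_def using nonneg by (rule integral_nonneg_AE)
  ultimately show ?thesis
    by simp
qed

definition ext_beta_kernel :: "real \<Rightarrow> real \<Rightarrow> real \<Rightarrow> real \<Rightarrow> real \<Rightarrow> real" where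
  "ext_beta_kernel x y p q t =
     t powr (x - 1) * (1 - t) powr (y - 1) * exp (- p / t - q / (1 - t))"

lemma ext_beta_kernel_pos: "t \<in> {0<..<1} \<Longrightarrow> ext_beta_kernel x y p q t > 0"
  by (simp add: ext_beta_kernel_def)

text \<open>The exponential factor is at most 1, so the classical beta kernel is an integrable majorant.\<close>

lemma set_integrable_ext_beta_kernel:
  assumes "x > 0" "y > 0" "p \<ge> 0" "q \<ge> 0"
  shows "set_integrable lborel {0<..<1} (ext_beta_kernel x y p q)"
proof (rule set_integrable_bound)
  show "set_integrable lborel {0<..<1} (\<lambda>t. t powr (x - 1) * (1 - t) powr (y - 1))"
    by (rule set_integrable_subset[OF integrable_Beta[OF assms(1,2)]]) auto
  show "set_borel_measurable lborel {0<..<1} (ext_beta_kernel x y p q)"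
    unfolding set_borel_measurable_def ext_beta_kernel_def by measurable
  have "norm (ext_beta_kernel x y p q t) \<le> norm (t powr (x - 1) * (1 - t) powr (y - 1))"
    if "t \<in> {0<..<1}" for t
  proof -
    have "exp (- p / t - q / (1 - t)) \<le> 1"
    proof -
      have "p / t \<ge> 0" "q / (1 - t) \<ge> 0"
        using that assms by simp_all
      then show ?thesis
        by simp
    qed
    then show ?thesis
      using that by (simp add: ext_beta_kernel_def abs_mult mult_left_le)
  qed
  then show "AE t in lborel. t \<in> {0<..<1} \<longrightarrow>
      norm (ext_beta_kernel x y p q t) \<le> norm (t powr (x - 1) * (1 - t) powr (y - 1))"
    by auto
qed

lemma ext_beta_eq: "ext_beta p q x y = (LBINT t:{0<..<1}. ext_beta_kernel x y p q t)"
  by (simp add: ext_beta_def ext_beta_kernel_def)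

lemma ext_beta_pos:
  assumes "x > 0" "y > 0" "p \<ge> 0" "q \<ge> 0"
  shows "ext_beta p q x y > 0"
  unfolding ext_beta_eq
  by (intro set_integral_pos set_integrable_ext_beta_kernel ext_beta_kernel_pos assms) auto

text \<open>
  The logarithm of the kernel is affine in \<open>(p, q)\<close>; the weight survives unchanged because the
  exponents \<open>\<alpha>\<close> and \<open>1 - \<alpha>\<close> add up to 1.
\<close>

lemma ext_beta_kernel_log_affine:
  assumes t: "t \<in> {0<..<1}"
  shows "ext_beta_kernel x y (\<alpha> * p + (1 - \<alpha>) * p') (\<alpha> * q + (1 - \<alpha>) * q') t
         = ext_beta_kernel x y p q t powr \<alpha> * ext_beta_kernel x y p' q' t powr (1 - \<alpha>)"
proof -
  define w where "w = t powr (x - 1) * (1 - t) powr (y - 1)"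
  define L where "L p q = - p / t - q / (1 - t)" for p q
  have "w > 0"
    using t by (simp add: w_def)
  have "L (\<alpha> * p + (1 - \<alpha>) * p') (\<alpha> * q + (1 - \<alpha>) * q') = \<alpha> * L p q + (1 - \<alpha>) * L p' q'"
    by (simp add: L_def diff_divide_distrib add_divide_distrib algebra_simps)
  moreover have "w = w powr \<alpha> * w powr (1 - \<alpha>)"
    using \<open>w > 0\<close> by (simp flip: powr_add)
  ultimately have "w * exp (L (\<alpha> * p + (1 - \<alpha>) * p') (\<alpha> * q + (1 - \<alpha>) * q'))
      = (w * exp (L p q)) powr \<alpha> * (w * exp (L p' q')) powr (1 - \<alpha>)"
    using \<open>w > 0\<close> by (simp add: powr_mult exp_add exp_powr_real mult_ac)
  then show ?thesis
    by (simp add: ext_beta_kernel_def w_def L_def)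
qed

lemma ext_beta_log_convex:
  assumes "x > 0" "y > 0"
  shows "log_convex_on ({0<..} \<times> {0<..}) (\<lambda>(p, q). ext_beta p q x y)"
proof -
  have "ext_beta (\<alpha> * p + (1 - \<alpha>) * p') (\<alpha> * q + (1 - \<alpha>) * q') x y
          \<le> ext_beta p q x y powr \<alpha> * ext_beta p' q' x y powr (1 - \<alpha>)"
    if pos: "p > 0" "q > 0" "p' > 0" "q' > 0" and \<alpha>: "0 < \<alpha>" "\<alpha> < 1" for p q p' q' \<alpha>
  proof -
    \<comment> \<open>Extension by zero turns the integrals into integrals over the line, and the identity
      between the kernels at the three parameter points survives since \<open>0 powr c = 0\<close>.\<close>
    define k where "k p q t = indicator {0<..<1} t * ext_beta_kernel x y p q t" for p q t
    have eq: "ext_beta p q x y = (LBINT t. k p q t)" for p q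
      by (simp add: ext_beta_eq k_def set_lebesgue_integral_def)
    have int: "integrable lborel (k p q)" if "p > 0" "q > 0" for p q
      using set_integrable_ext_beta_kernel[OF assms, of p q] that
      by (simp add: k_def[abs_def] set_integrable_def)
    have nonneg: "k p q t \<ge> 0" for p q t
      using ext_beta_kernel_pos[of t x y p q] by (auto simp: k_def indicator_def)
    have "k (\<alpha> * p + (1 - \<alpha>) * p') (\<alpha> * q + (1 - \<alpha>) * q')
            = (\<lambda>t. k p q t powr \<alpha> * k p' q' t powr (1 - \<alpha>))"
      using ext_beta_kernel_log_affine by (auto simp: k_def indicator_def)
    then show ?thesis
      unfolding eq using Hoelder_inequality_integral[OF int int nonneg nonneg \<alpha>] pos by simp
  qed
  moreover have "convex ({0::real<..} \<times> {0::real<..})"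
    by (intro convex_Times convex_real_interval)
  ultimately show ?thesis
    using ext_beta_pos[OF assms] by (auto simp: log_convex_on_def)
qed

lemma log_convex_on_midpoint:
  assumes f: "log_convex_on S f" and uv: "u \<in> S" "v \<in> S"
  shows "(f (midpoint u v))\<^sup>2 \<le> f u * f v"
proof -
  have pos: "f z > 0" if "z \<in> S" for z
    using f that by (simp add: log_convex_on_def)
  have mid: "midpoint u v = (1/2) *\<^sub>R u + (1 - 1/2) *\<^sub>R v"
    by (simp add: midpoint_def scaleR_add_right)
  have S: "midpoint u v \<in> S"
    unfolding mid using f uv by (intro convexD) (auto simp: log_convex_on_def)
  have "(1/2::real) \<in> {0<..<1}"
    by simp
  then have "f (midpoint u v) \<le> f u powr (1/2) * f v powr (1 - 1/2)"
    unfolding mid using f uv unfolding log_convex_on_def by blast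
  also have "\<dots> = sqrt (f u * f v)"
    using pos uv by (simp add: powr_half_sqrt real_sqrt_mult less_imp_le)
  finally have "(f (midpoint u v))\<^sup>2 \<le> (sqrt (f u * f v))\<^sup>2"
    using pos[OF S] by (intro power_mono) auto
  then show ?thesis
    using pos uv by (simp add: less_imp_le)
qed

theorem theorem2:
  shows "(\<forall>x>0. \<forall>y>0. log_convex_on ({0<..} \<times> {0<..}) (\<lambda>(p, q). ext_beta p q x y)) \<and>
    (\<forall>x>0. \<forall>y>0. \<forall>p>0. \<forall>q>0. \<forall>a::real.
       p + a > 0 \<and> p - a > 0 \<and> q + a > 0 \<and> q - a > 0 \<longrightarrow>
       (ext_beta p q x y)\<^sup>2 - ext_beta (p + a) (q + a) x y * ext_beta (p - a) (q - a) x y \<le> 0)"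
proof (intro conjI allI impI)
  fix x y :: real
  assume "x > 0" "y > 0"
  then show "log_convex_on ({0<..} \<times> {0<..}) (\<lambda>(p, q). ext_beta p q x y)"
    by (rule ext_beta_log_convex)
next
  fix x y p q a :: real
  assume "x > 0" "y > 0" and a: "p + a > 0 \<and> p - a > 0 \<and> q + a > 0 \<and> q - a > 0"
  have "midpoint (p + a, q + a) (p - a, q - a) = (p, q)"
    by (simp add: midpoint_def)
  then show "(ext_beta p q x y)\<^sup>2
      - ext_beta (p + a) (q + a) x y * ext_beta (p - a) (q - a) x y \<le> 0"
    using log_convex_on_midpoint[OF ext_beta_log_convex[OF \<open>x > 0\<close> \<open>y > 0\<close>],
        of "(p + a, q + a)" "(p - a, q - a)"] a
    by simp
qed

end
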